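(* Let $n\ge3$ and let $\beta$ be a permutation of $\{1,\dots,n\}$ with $\beta(1)=1$, $\beta(n-1)=n-1$, $\beta(n)=n$. The Parke–Taylor form $$\mathsf{PT}(\beta):=\frac{dz_{2}\wedge dz_{3}\wedge\cdots\wedge dz_{n-2}}{(0-z_{\beta(2)})(z_{\beta(2)}-z_{\beta(3)})\cdots(z_{\beta(n-3)}-z_{\beta(n-2)})(z_{\beta(n-2)}-1)}$$ can be represented as the logarithmic $(n-3)$-form $$\mathsf{PT}(\beta)=(-1)^n\,\mathrm{sgn}(\beta)\;d\log\!\left(\frac{0-z_{\beta(2)}}{z_{\beta(2),\beta(3)}}\right)\wedge d\log\!\left(\frac{z_{\beta(2),\beta(3)}}{z_{\beta(3),\beta(4)}}\right)\wedge\cdots\wedge d\log\!\left(\frac{z_{\beta(n-3),\beta(n-2)}}{z_{\beta(n-2)}-1}\right),$$ where $z_{ab}:=z_a-z_b$.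
   Context: The forms are considered on $\mathcal{M}_{0,n}=\{(z_2,\dots,z_{n-2})\in\mathbb{C}^{n-3}: z_i\neq 0,1,\ z_i\ne z_j\text{ for } i\neq j\}$, with the gauge fixing $(z_1,z_{n-1},z_n)=(0,1,\infty)$. $\mathrm{sgn}(\beta)$ is the sign of the permutation. The denominators run along the chain $0=z_1,z_{\beta(2)},\dots,z_{\beta(n-2)},z_{n-1}=1$ of consecutive points, giving $n-2$ differences, and the $n-3$ logarithmic factors are $d\log$ of ratios of consecutive differences. In the degenerate cases: for $n=3$ the wedge product is empty (equal to $1$) and $\mathsf{PT}=1/(0-1)=-1$; for $n=4$ the single factor is $d\log\frac{0-z_2}{z_2-1}$. *)

theory Defs
  imports "HOL-Analysis.Analysis" "HOL-Combinatorics.Permutations"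
begin

text \<open>
  Points of and tangent vectors to the space \<open>\<complex>^(n-3)\<close> are functions \<open>nat \<Rightarrow> complex\<close> of which only
  the coordinates with index in \<open>{2..n-2}\<close> matter; for \<open>n = 3\<close> this is a single point.
\<close>

type_synonym point = "nat \<Rightarrow> complex"

definition moduli_space :: "nat \<Rightarrow> point set" where
  "moduli_space n =
     {z \<in> {2..n-2} \<rightarrow>\<^sub>E UNIV.
        (\<forall>i\<in>{2..n-2}. z i \<noteq> 0 \<and> z i \<noteq> 1) \<and>
        (\<forall>i\<in>{2..n-2}. \<forall>j\<in>{2..n-2}. i \<noteq> j \<longrightarrow> z i \<noteq> z j)}"

text \<open>
  The marked points \<open>z_1, \<dots>, z_(n-1)\<close> after the gauge fixing \<open>(z_1, z_(n-1), z_n) = (0, 1, \<infinity>)\<close>.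
  The point \<open>z_n\<close> at infinity occurs in no formula.
\<close>

definition marked :: "nat \<Rightarrow> point \<Rightarrow> nat \<Rightarrow> complex" where
  "marked n z i = (if i = 1 then 0 else if i = n - 1 then 1 else z i)"

definition zdiff :: "nat \<Rightarrow> nat \<Rightarrow> nat \<Rightarrow> point \<Rightarrow> complex" where
  "zdiff n a b z = marked n z a - marked n z b"

text \<open>
  A \<open>k\<close>-form assigns to a point \<open>z\<close> an alternating multilinear function of \<open>k\<close> tangent vectors
  \<open>v 0, \<dots>, v (k-1)\<close>; the values of \<open>v\<close> from index \<open>k\<close> on are ignored. The degree \<open>k\<close> is not
  part of the type, so the wedge product takes the two degrees as arguments.
\<close>

type_synonym form = "point \<Rightarrow> (nat \<Rightarrow> point) \<Rightarrow> complex"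

text \<open>
  Wedge product of a \<open>p\<close>-form and a \<open>q\<close>-form, normalised such that
  \<open>(\<omega> \<and> \<eta>)(v, w) = \<omega>(v) \<eta>(w) - \<omega>(w) \<eta>(v)\<close> for 1-forms.
\<close>

definition wedge :: "nat \<Rightarrow> nat \<Rightarrow> form \<Rightarrow> form \<Rightarrow> form" where
  "wedge p q \<omega> \<eta> z v =
     (\<Sum>\<sigma> | \<sigma> permutes {..<p+q}.
        of_int (sign \<sigma>) * \<omega> z (\<lambda>i. v (\<sigma> i)) * \<eta> z (\<lambda>i. v (\<sigma> (p + i)))) / (fact p * fact q)"

text \<open>All members of the list are meant to be 1-forms.\<close>

primrec wedge_list :: "form list \<Rightarrow> form" where
  "wedge_list [] = (\<lambda>z v. 1)"
| "wedge_list (\<alpha> # \<alpha>s) = wedge 1 (length \<alpha>s) \<alpha> (wedge_list \<alpha>s)"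

definition dz :: "nat \<Rightarrow> form" where
  "dz i z v = v 0 i"

definition partial_deriv :: "nat \<Rightarrow> (point \<Rightarrow> complex) \<Rightarrow> point \<Rightarrow> complex" where
  "partial_deriv i f z = deriv (\<lambda>w. f (z(i := w))) (z i)"

text \<open>The differential of a holomorphic function.\<close>

definition differential :: "nat \<Rightarrow> (point \<Rightarrow> complex) \<Rightarrow> form" where
  "differential n f z v = (\<Sum>i=2..n-2. partial_deriv i f z * dz i z v)"

text \<open>As usual, \<open>d log f\<close> means \<open>df / f\<close>, so that no branch of the logarithm is chosen.\<close>

definition dlog :: "nat \<Rightarrow> (point \<Rightarrow> complex) \<Rightarrow> form" where
  "dlog n f z v = differential n f z v / f z"

text \<open>
  For \<open>\<beta> 1 = 1\<close> and \<open>\<beta> (n-1) = n-1\<close>, the first and the last factor of the denominator are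
  \<open>0 - z_\<beta>(2)\<close> and \<open>z_\<beta>(n-2) - 1\<close> (for \<open>n = 3\<close> the only factor is \<open>0 - 1\<close>).
\<close>

definition parke_taylor :: "nat \<Rightarrow> (nat \<Rightarrow> nat) \<Rightarrow> form" where
  "parke_taylor n \<beta> z v =
     wedge_list (map dz [2..<n-1]) z v / (\<Prod>j=1..n-2. zdiff n (\<beta> j) (\<beta> (j+1)) z)"

end

theory Submission
  imports Defs "Jordan_Normal_Form.Determinant"
begin

text \<open>
  A wedge product of one-forms, evaluated on tangent vectors \<open>v\<^sub>j\<close>, is the determinant of the
  matrix of its values. Write \<open>p\<^sub>0 = 0, p\<^sub>1, \<dots>, p\<^sub>m\<^sub>+\<^sub>1 = 1\<close> for the marked points along the chain,
  \<open>m = n - 3\<close>, and \<open>\<omega>\<^sub>i = d log (p\<^sub>i - p\<^sub>i\<^sub>+\<^sub>1)\<close>. Abel summation telescopes the combinations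
  \<open>\<Sum>k\<le>i. p\<^sub>k\<^sub>+\<^sub>1 (\<omega>\<^sub>k - \<omega>\<^sub>k\<^sub>+\<^sub>1)\<close> to \<open>dp\<^sub>i\<^sub>+\<^sub>1 - p\<^sub>i\<^sub>+\<^sub>1 \<omega>\<^sub>i\<^sub>+\<^sub>1\<close>, which involves only \<open>dp\<^sub>i\<^sub>+\<^sub>1\<close> and \<open>dp\<^sub>i\<^sub>+\<^sub>2\<close>.
  Hence the coefficient matrix of the logarithmic forms becomes upper triangular after
  multiplication by a lower triangular matrix, and both determinants can be read off.
\<close>

section \<open>Wedge products of one-forms as determinants\<close>

text \<open>Expanding head and tail by the Leibniz formula yields every permutation of
  \<open>Suc k\<close> positions exactly \<open>k!\<close> times, which cancels the normalisation of
  \<open>wedge\<close>. The hypothesis expresses that the members are one-forms: they read only the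
  first tangent vector.\<close>

lemma wedge_list_eq_det:
  assumes "\<And>\<alpha> v w. \<alpha> \<in> set \<alpha>s \<Longrightarrow> v 0 = w 0 \<Longrightarrow> \<alpha> z v = \<alpha> z w"
  shows "wedge_list \<alpha>s z v =
    det (mat (length \<alpha>s) (length \<alpha>s) (\<lambda>(i, j). (\<alpha>s ! i) z (\<lambda>_. v j)))"
  using assms
proof (induction \<alpha>s arbitrary: v)
  case Nil
  show ?case by simp
next
  case (Cons \<alpha> \<alpha>s)
  define k where "k = length \<alpha>s"
  \<comment> \<open>The Leibniz term of \<open>\<rho>\<close> in the determinant of size
    \<open>Suc k\<close>.\<close>
  define F where "F \<rho> = signof \<rho> * \<alpha> z (\<lambda>_. v (\<rho> 0)) *
    (\<Prod>i<k. (\<alpha>s ! i) z (\<lambda>_. v (\<rho> (Suc i))))" for \<rho> :: "nat \<Rightarrow> nat"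
  let ?S = "{\<sigma>. \<sigma> permutes {..<Suc k}}" and ?T = "{\<tau>. \<tau> permutes {..<k}}"
  \<comment> \<open>The embedding of the permutations of the tail positions as the stabiliser of
    position 0, where the head form sits.\<close>
  define shift where "shift \<tau> = map_permutation {..<k} Suc \<tau>" for \<tau>
  have shift0: "shift \<tau> 0 = 0" and shiftS: "\<And>i. i < k \<Longrightarrow> shift \<tau> (Suc i) = Suc (\<tau> i)"
    and shift_perm: "shift \<tau> permutes {..<Suc k}" and sign_shift: "sign (shift \<tau>) = sign \<tau>"
    if "\<tau> permutes {..<k}" for \<tau>
  proof -
    have perm: "shift \<tau> permutes Suc ` {..<k}"
      unfolding shift_def using that by (intro map_permutation_permutes) (auto simp: bij_betw_def)
    show "shift \<tau> 0 = 0" using permutes_not_in[OF perm] by simp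
    show "shift \<tau> (Suc i) = Suc (\<tau> i)" if "i < k" for i
      using that unfolding shift_def by (simp add: map_permutation_apply)
    show "shift \<tau> permutes {..<Suc k}"
      using perm by (rule permutes_subset) auto
    show "sign (shift \<tau>) = sign \<tau>"
      unfolding shift_def using that by (intro sign_map_permutation) auto
  qed
  have IH: "wedge_list \<alpha>s z w = (\<Sum>\<tau>\<in>?T. signof \<tau> * (\<Prod>i<k. (\<alpha>s ! i) z (\<lambda>_. w (\<tau> i))))" for w
  proof -
    have "wedge_list \<alpha>s z w = det (mat k k (\<lambda>(i, j). (\<alpha>s ! i) z (\<lambda>_. w j)))"
      unfolding k_def using Cons.prems by (intro Cons.IH) auto
    also have "\<dots> = (\<Sum>\<tau>\<in>?T. signof \<tau> * (\<Prod>i<k. (\<alpha>s ! i) z (\<lambda>_. w (\<tau> i))))"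
    proof -
      have "mat k k (\<lambda>(i, j). (\<alpha>s ! i) z (\<lambda>_. w j)) $$ (i, \<tau> i) = (\<alpha>s ! i) z (\<lambda>_. w (\<tau> i))"
        if "\<tau> permutes {..<k}" "i < k" for \<tau> i
        using permutes_in_image[OF that(1), of i] that(2) by simp
      then show ?thesis
        by (subst det_def'[of _ k]) (auto simp: atLeast0LessThan intro!: sum.cong prod.cong)
    qed
    finally show ?thesis .
  qed
  have head: "\<alpha> z (\<lambda>i. v (\<sigma> i)) = \<alpha> z (\<lambda>_. v (\<sigma> 0))" for \<sigma>
    by (rule Cons.prems) auto
  have summand: "signof \<sigma> * \<alpha> z (\<lambda>i. v (\<sigma> i)) * wedge_list \<alpha>s z (\<lambda>i. v (\<sigma> (1 + i))) =
      (\<Sum>\<tau>\<in>?T. F (\<sigma> \<circ> shift \<tau>))" if "\<sigma> \<in> ?S" for \<sigma>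
  proof -
    have "F (\<sigma> \<circ> shift \<tau>) = signof \<sigma> * \<alpha> z (\<lambda>i. v (\<sigma> i)) *
        (signof \<tau> * (\<Prod>i<k. (\<alpha>s ! i) z (\<lambda>_. v (\<sigma> (1 + \<tau> i)))))" if \<tau>: "\<tau> \<in> ?T" for \<tau>
    proof -
      have "sign (\<sigma> \<circ> shift \<tau>) = sign \<sigma> * sign \<tau>"
        using shift_perm[of \<tau>] sign_shift[of \<tau>] \<tau> \<open>\<sigma> \<in> ?S\<close>
        by (simp add: sign_compose permutes_imp_permutation[OF finite_lessThan])
      then show ?thesis
        using shift0[of \<tau>] shiftS[of \<tau>] \<tau> by (simp add: F_def head[of \<sigma>])
    qed
    then show ?thesis by (simp add: IH sum_distrib_left)
  qed
  have "wedge_list (\<alpha> # \<alpha>s) z v =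
      (\<Sum>\<sigma>\<in>?S. signof \<sigma> * \<alpha> z (\<lambda>i. v (\<sigma> i)) * wedge_list \<alpha>s z (\<lambda>i. v (\<sigma> (1 + i)))) / fact k"
    unfolding wedge_list.simps wedge_def k_def[symmetric] by simp
  also have "(\<Sum>\<sigma>\<in>?S. signof \<sigma> * \<alpha> z (\<lambda>i. v (\<sigma> i)) * wedge_list \<alpha>s z (\<lambda>i. v (\<sigma> (1 + i)))) =
      (\<Sum>\<sigma>\<in>?S. \<Sum>\<tau>\<in>?T. F (\<sigma> \<circ> shift \<tau>))"
    by (rule sum.cong[OF refl summand])
  also have "(\<Sum>\<sigma>\<in>?S. \<Sum>\<tau>\<in>?T. F (\<sigma> \<circ> shift \<tau>)) = (\<Sum>\<tau>\<in>?T. \<Sum>\<sigma>\<in>?S. F (\<sigma> \<circ> shift \<tau>))"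
    by (rule sum.swap)
  \<comment> \<open>Right composition with a fixed \<open>shift \<tau>\<close> is a bijection of
    \<open>?S\<close>, so the inner sum does not depend on \<open>\<tau>\<close>.\<close>
  also have "\<dots> = (\<Sum>\<tau>\<in>?T. sum F ?S)"
    using shift_perm by (intro sum.cong refl sum_permutations_compose_right[symmetric]) auto
  also have "\<dots> = fact k * sum F ?S"
    by (simp add: card_permutations)
  finally have "wedge_list (\<alpha> # \<alpha>s) z v = sum F ?S" by simp
  also have "\<dots> = det (mat (Suc k) (Suc k) (\<lambda>(i, j). ((\<alpha> # \<alpha>s) ! i) z (\<lambda>_. v j)))"
  proof -
    have "F \<sigma> = signof \<sigma> * (\<Prod>i<Suc k.
        mat (Suc k) (Suc k) (\<lambda>(i, j). ((\<alpha> # \<alpha>s) ! i) z (\<lambda>_. v j)) $$ (i, \<sigma> i))"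
      if "\<sigma> permutes {..<Suc k}" for \<sigma>
    proof -
      have "\<sigma> i < Suc k" if "i < Suc k" for i
        using permutes_in_image[OF \<open>\<sigma> permutes _\<close>, of i] that by simp
      then have "(\<Prod>i<Suc k. mat (Suc k) (Suc k) (\<lambda>(i, j). ((\<alpha> # \<alpha>s) ! i) z (\<lambda>_. v j)) $$ (i, \<sigma> i))
          = (\<Prod>i<Suc k. ((\<alpha> # \<alpha>s) ! i) z (\<lambda>_. v (\<sigma> i)))"
        by (intro prod.cong) auto
      then show ?thesis
        unfolding F_def by (simp add: prod.lessThan_Suc_shift del: prod.lessThan_Suc)
    qed
    then show ?thesis
      by (subst det_def'[of _ "Suc k"]) (auto simp: atLeast0LessThan intro!: sum.cong)
  qed
  finally show ?case by (simp add: k_def)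
qed

section \<open>The determinant of logarithmic differentials along a chain\<close>

text \<open>Here \<open>W i j\<close> stands for the value of \<open>dp_i\<close> on the
  \<open>j\<close>-th tangent vector; it vanishes at both ends because the end points are fixed.
  Comparing determinants in \<open>A * M = T * V\<close> gives the result, and \<open>nz\<close>
  allows division by \<open>det A\<close>.\<close>

lemma det_dlog_chain:
  fixes p :: "nat \<Rightarrow> 'a :: field" and W :: "nat \<Rightarrow> nat \<Rightarrow> 'a"
  assumes p0: "p 0 = 0" and W0: "\<And>j. W 0 j = 0" and Wlast: "\<And>j. W (Suc m) j = 0"
    and neq: "\<And>i. i \<le> m \<Longrightarrow> p i \<noteq> p (Suc i)" and nz: "\<And>i. i < m \<Longrightarrow> p (Suc i) \<noteq> 0"
  defines "\<omega> \<equiv> \<lambda>i j. (W i j - W (Suc i) j) / (p i - p (Suc i))"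
  shows "det (mat m m (\<lambda>(i, j). \<omega> i j - \<omega> (Suc i) j)) * (\<Prod>i\<le>m. p i - p (Suc i)) =
    (-1) ^ Suc m * p (Suc m) * det (mat m m (\<lambda>(i, j). W (Suc i) j))"
proof -
  define M where "M = mat m m (\<lambda>(i, j). \<omega> i j - \<omega> (Suc i) j)"
  define V where "V = mat m m (\<lambda>(i, j). W (Suc i) j)"
  define A where "A = mat m m (\<lambda>(i, k). if k \<le> i then p (Suc k) else 0)"
  define x where "x i = p i - p (Suc i)" for i
  define T where "T = mat m m (\<lambda>(i, l). if l = i then - p (Suc (Suc i)) / x (Suc i)
    else if l = Suc i then p (Suc i) / x (Suc i) else 0)"
  have carr: "M \<in> carrier_mat m m" "V \<in> carrier_mat m m" "A \<in> carrier_mat m m" "T \<in> carrier_mat m m"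
    by (auto simp: M_def V_def A_def T_def)
  have x: "x i \<noteq> 0" if "i \<le> m" for i
    using neq[OF that] by (simp add: x_def)
  have telescope: "(\<Sum>k\<le>i. p (Suc k) * (\<omega> k j - \<omega> (Suc k) j)) =
      W (Suc i) j - p (Suc i) * \<omega> (Suc i) j" if "i < m" for i j
    using that
  proof (induction i)
    case 0
    \<comment> \<open>With \<open>p 0 = 0\<close> and \<open>W 0 j = 0\<close>, the form
      \<open>\<omega> 0\<close> is the logarithmic differential of \<open>p 1\<close>.\<close>
    have "p (Suc 0) * \<omega> 0 j = W (Suc 0) j"
      using neq[of 0] p0 by (simp add: \<omega>_def W0)
    then show ?case by (simp add: algebra_simps)
  next
    case (Suc i)
    \<comment> \<open>Consecutive coefficients of \<open>\<omega> (Suc i)\<close> differ by exactly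
      its denominator, which therefore cancels.\<close>
    have step: "x (Suc i) * \<omega> (Suc i) j = W (Suc i) j - W (Suc (Suc i)) j"
      using x[of "Suc i"] Suc.prems by (simp add: \<omega>_def x_def)
    have "(\<Sum>k\<le>Suc i. p (Suc k) * (\<omega> k j - \<omega> (Suc k) j)) =
        W (Suc i) j - p (Suc i) * \<omega> (Suc i) j +
        p (Suc (Suc i)) * (\<omega> (Suc i) j - \<omega> (Suc (Suc i)) j)"
      using Suc by simp
    also have "\<dots> = W (Suc i) j - x (Suc i) * \<omega> (Suc i) j - p (Suc (Suc i)) * \<omega> (Suc (Suc i)) j"
      by (simp add: x_def algebra_simps)
    finally show ?case by (simp add: step)
  qed
  have entry: "(A * M) $$ (i, j) = (T * V) $$ (i, j)" if ij: "i < m" "j < m" for i j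
  proof -
    have "(A * M) $$ (i, j) = (\<Sum>k<m. (if k \<le> i then p (Suc k) else 0) * (\<omega> k j - \<omega> (Suc k) j))"
      using ij by (simp add: A_def M_def scalar_prod_def atLeast0LessThan)
    also have "\<dots> = (\<Sum>k\<le>i. p (Suc k) * (\<omega> k j - \<omega> (Suc k) j))"
      using ij by (intro sum.mono_neutral_cong_right) auto
    also have "\<dots> = W (Suc i) j - p (Suc i) * \<omega> (Suc i) j"
      by (rule telescope) fact
    \<comment> \<open>Expanding \<open>\<omega> (Suc i)\<close> leaves \<open>W (Suc i) j\<close>
      with coefficient \<open>1 - p (Suc i) / x (Suc i)\<close>, whose numerator is
      \<open>x (Suc i) - p (Suc i) = - p (Suc (Suc i))\<close>.\<close>
    also have "\<dots> = - p (Suc (Suc i)) / x (Suc i) * W (Suc i) j + p (Suc i) / x (Suc i) * W (Suc (Suc i)) j"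
    proof -
      have eqs: "\<omega> (Suc i) j = (W (Suc i) j - W (Suc (Suc i)) j) / x (Suc i)"
        "p (Suc (Suc i)) = p (Suc i) - x (Suc i)"
        by (simp_all add: \<omega>_def x_def)
      show ?thesis unfolding eqs using x[of "Suc i"] ij by (simp add: field_simps)
    qed
    also have "\<dots> = (\<Sum>l\<in>{i, Suc i}. (if l = i then - p (Suc (Suc i)) / x (Suc i)
        else if l = Suc i then p (Suc i) / x (Suc i) else 0) * W (Suc l) j)"
      by simp
    also have "\<dots> = (\<Sum>l<m. (if l = i then - p (Suc (Suc i)) / x (Suc i)
        else if l = Suc i then p (Suc i) / x (Suc i) else 0) * W (Suc l) j)"
    proof (cases "Suc i < m")
      case True
      then show ?thesis by (intro sum.mono_neutral_cong_left) auto
    next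
      \<comment> \<open>In the last row the superdiagonal entry would lie outside the matrix; its
        term is zero by \<open>Wlast\<close>.\<close>
      case False
      then have "m = Suc i" using ij by simp
      then show ?thesis using Wlast[of j] by (simp add: sum.neutral)
    qed
    also have "\<dots> = (T * V) $$ (i, j)"
      using ij by (simp add: T_def V_def scalar_prod_def atLeast0LessThan)
    finally show ?thesis .
  qed
  have "A * M = T * V"
    by (rule eq_matI) (use carr entry in auto)
  then have dets: "det A * det M = det T * det V"
    using det_mult[of A m M] det_mult[of T m V] carr by simp
  have detA: "det A = (\<Prod>i<m. p (Suc i))"
    by (subst det_lower_triangular[OF _ carr(3)])
       (auto simp: A_def prod_list_diag_prod atLeast0LessThan)
  have "upper_triangular T"
    by (auto simp: T_def)
  then have detT: "det T = (\<Prod>i<m. - p (Suc (Suc i)) / x (Suc i))"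
    by (subst det_upper_triangular[OF _ carr(4)])
       (auto simp: T_def prod_list_diag_prod atLeast0LessThan)
  \<comment> \<open>Both sides are the product of \<open>p 1\<close> to \<open>p (Suc m)\<close>,
    split at opposite ends; this turns the numerators of \<open>det T\<close> into
    \<open>det A\<close>.\<close>
  have shift: "p (Suc 0) * (\<Prod>i<m. p (Suc (Suc i))) = (\<Prod>i<m. p (Suc i)) * p (Suc m)"
    using prod.lessThan_Suc_shift[of "\<lambda>i. p (Suc i)" m] prod.lessThan_Suc[of "\<lambda>i. p (Suc i)" m]
    by simp
  have detA_nz: "det A \<noteq> 0"
    using nz by (simp add: detA)
  have T': "det T * (\<Prod>i<m. x (Suc i)) = (-1) ^ m * (\<Prod>i<m. p (Suc (Suc i)))"
  proof -
    have "det T * (\<Prod>i<m. x (Suc i)) = (\<Prod>i<m. - p (Suc (Suc i)) / x (Suc i) * x (Suc i))"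
      unfolding detT by (simp only: prod.distrib)
    also have "\<dots> = (\<Prod>i<m. (-1) * p (Suc (Suc i)))"
      using x by (intro prod.cong) auto
    finally show ?thesis by (simp only: prod.distrib prod_constant card_lessThan)
  qed
  \<comment> \<open>The first factor \<open>x 0 = - p 1\<close> supplies the missing
    \<open>p 1\<close> and one more sign.\<close>
  have full: "(\<Prod>i\<le>m. x i) = - p (Suc 0) * (\<Prod>i<m. x (Suc i))"
    using prod.lessThan_Suc_shift[of x m] p0 by (simp add: lessThan_Suc_atMost x_def)
  have "det A * (det M * (\<Prod>i\<le>m. x i)) = det T * (\<Prod>i<m. x (Suc i)) * (- p (Suc 0)) * det V"
    unfolding full using dets by (metis (no_types) mult.assoc mult.commute)
  also have "\<dots> = - ((-1) ^ m) * (p (Suc 0) * (\<Prod>i<m. p (Suc (Suc i)))) * det V"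
    unfolding T' by simp
  also have "\<dots> = det A * ((-1) ^ Suc m * p (Suc m) * det V)"
    unfolding shift detA by simp
  finally have "det M * (\<Prod>i\<le>m. x i) = (-1) ^ Suc m * p (Suc m) * det V"
    by (simp only: mult_left_cancel[OF detA_nz])
  then show ?thesis by (simp only: M_def V_def x_def)
qed

section \<open>Differentials of the marked points and their differences\<close>

text \<open>The differential of the \<open>b\<close>-th marked point. The value zero for the
  gauge-fixed points lets the end factors of the chain be treated like the others.\<close>

definition dmarked :: "nat \<Rightarrow> nat \<Rightarrow> form" where
  "dmarked n b z v = (if b \<in> {2..n-2} then v 0 b else 0)"

lemma zdiff_upd_deriv:
  assumes "i \<in> {2..n-2}"
  shows "((\<lambda>w. zdiff n a b (z(i := w))) has_field_derivative
    (of_bool (a = i) - of_bool (b = i))) (at w)"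
proof -
  have "((\<lambda>w. marked n (z(i := w)) b) has_field_derivative of_bool (b = i)) (at w)" for b
  proof -
    have "(\<lambda>w. marked n (z(i := w)) b) = (if b = i then (\<lambda>w. w) else (\<lambda>_. marked n z b))"
      using assms by (auto simp: marked_def)
    then show ?thesis by simp
  qed
  then show ?thesis
    unfolding zdiff_def by (intro DERIV_diff)
qed

text \<open>The quotient rule in each coordinate gives \<open>df / f - dg / g\<close>, without any
  branch of the logarithm.\<close>

lemma dlog_zdiff_quotient:
  assumes "zdiff n a b z \<noteq> 0" and "zdiff n c d z \<noteq> 0"
  shows "dlog n (\<lambda>x. zdiff n a b x / zdiff n c d x) z v =
    (dmarked n a z v - dmarked n b z v) / zdiff n a b z -
    (dmarked n c z v - dmarked n d z v) / zdiff n c d z"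
proof -
  let ?f = "zdiff n a b z" and ?g = "zdiff n c d z"
  let ?d = "\<lambda>a b i. of_bool (a = i) - of_bool (b = i) :: complex"
  have pd: "partial_deriv i (\<lambda>x. zdiff n a b x / zdiff n c d x) z =
      (?d a b i * ?g - ?f * ?d c d i) / (?g * ?g)" if "i \<in> {2..n-2}" for i
  proof -
    have "((\<lambda>w. zdiff n a b (z(i := w)) / zdiff n c d (z(i := w))) has_field_derivative
        (?d a b i * ?g - ?f * ?d c d i) / (?g * ?g)) (at (z i))"
      using DERIV_divide[OF zdiff_upd_deriv[OF that, of a b z "z i"] zdiff_upd_deriv[OF that, of c d z "z i"]]
        assms by simp
    then show ?thesis
      unfolding partial_deriv_def by (rule DERIV_imp_deriv)
  qed
  have sum_delta: "(\<Sum>i=2..n-2. ?d a b i * v 0 i) = dmarked n a z v - dmarked n b z v" for a b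
    by (simp add: dmarked_def left_diff_distrib sum_subtractf of_bool_def if_distrib[of "\<lambda>t. t * _"] cong: if_cong)
  have "dlog n (\<lambda>x. zdiff n a b x / zdiff n c d x) z v =
      (\<Sum>i=2..n-2. (?d a b i * ?g - ?f * ?d c d i) / (?g * ?g) * v 0 i) / (?f / ?g)"
    unfolding dlog_def differential_def dz_def by (simp add: pd)
  also have "\<dots> = (\<Sum>i=2..n-2. ?d a b i * v 0 i / ?f - ?d c d i * v 0 i / ?g)"
    unfolding sum_divide_distrib using assms by (intro sum.cong refl) (simp add: field_simps)
  also have "\<dots> = (\<Sum>i=2..n-2. ?d a b i * v 0 i) / ?f - (\<Sum>i=2..n-2. ?d c d i * v 0 i) / ?g"
    by (simp only: sum_subtractf sum_divide_distrib)
  finally show ?thesis by (simp only: sum_delta)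
qed

lemma dmarked_cong: "v 0 = w 0 \<Longrightarrow> dmarked n b z v = dmarked n b z w"
  by (simp add: dmarked_def)

text \<open>Ensures that no denominator along the chain vanishes on the moduli space.\<close>

lemma marked_inj:
  assumes "n \<ge> 3" and "z \<in> moduli_space n" and "a \<in> {1..n-1}" and "b \<in> {1..n-1}" and "a \<noteq> b"
  shows "marked n z a \<noteq> marked n z b"
proof -
  have "a = 1 \<or> a = n - 1 \<or> a \<in> {2..n-2}" "b = 1 \<or> b = n - 1 \<or> b \<in> {2..n-2}"
    using assms by auto
  moreover have "marked n z 1 = 0" "marked n z (n - 1) = 1"
    using assms(1) by (auto simp: marked_def)
  moreover have "marked n z i = z i" "z i \<noteq> 0" "z i \<noteq> 1" if "i \<in> {2..n-2}" for i
    using assms(2) that by (auto simp: marked_def moduli_space_def)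
  moreover have "z i \<noteq> z j" if "i \<in> {2..n-2}" "j \<in> {2..n-2}" "i \<noteq> j" for i j
    using assms(2) that by (auto simp: moduli_space_def)
  ultimately show ?thesis
    using assms(5) by (metis zero_neq_one)
qed

text \<open>The source of the factor \<open>sign \<beta>\<close>. Translation by \<open>a\<close>
  conjugates \<open>\<beta>\<close> to a permutation of the row indices, which start at 0, and
  preserves the sign.\<close>

lemma det_permute_coordinates:
  assumes "\<beta> permutes {a..<a + m}"
  shows "det (mat m m (\<lambda>(i, j). w j (\<beta> (i + a)))) =
    signof \<beta> * det (mat m m (\<lambda>(i, j). w j (i + a) :: 'a :: comm_ring_1))"
proof -
  define \<pi> where "\<pi> = map_permutation {a..<a + m} (\<lambda>b. b - a) \<beta>"
  have inj: "inj_on (\<lambda>b. b - a) {a..<a + m}"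
    by (auto simp: inj_on_def)
  have "bij_betw (\<lambda>b. b - a) {a..<a + m} {0..<m}"
    by (rule bij_betwI[of _ _ _ "\<lambda>i. i + a"]) auto
  then have \<pi>: "\<pi> permutes {0..<m}"
    unfolding \<pi>_def using assms by (rule map_permutation_permutes)
  have sign: "sign \<pi> = sign \<beta>"
    unfolding \<pi>_def using inj assms by (intro sign_map_permutation) auto
  have \<pi>_eq: "\<pi> i + a = \<beta> (i + a) \<and> \<pi> i < m" if "i < m" for i
  proof -
    have "\<beta> (i + a) \<in> {a..<a + m}"
      using permutes_in_image[OF assms, of "i + a"] that by simp
    moreover have "\<pi> i = \<beta> (i + a) - a"
      using map_permutation_apply[OF inj, of "i + a" \<beta>] that by (simp add: \<pi>_def)
    ultimately show ?thesis by auto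
  qed
  have "mat m m (\<lambda>(i, j). w j (\<beta> (i + a))) =
      mat m m (\<lambda>(i, j). mat m m (\<lambda>(i, j). w j (i + a)) $$ (\<pi> i, j))"
    using \<pi>_eq by (intro eq_matI) auto
  then show ?thesis
    using det_permute_rows[OF mat_carrier \<pi>, of "\<lambda>(i, j). w j (i + a)"] sign by simp
qed

section \<open>Comparison of the two forms\<close>

theorem claim3p1:
  fixes n :: nat and \<beta> :: "nat \<Rightarrow> nat"
  assumes "n \<ge> 3"
    and "\<beta> permutes {1..n}"
    and "\<beta> 1 = 1" and "\<beta> (n - 1) = n - 1" and "\<beta> n = n"
  shows "\<forall>z\<in>moduli_space n. \<forall>v.
    parke_taylor n \<beta> z v =
      (-1) ^ n * of_int (sign \<beta>) *
      wedge_list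
        (map (\<lambda>j. dlog n (\<lambda>x. zdiff n (\<beta> j) (\<beta> (j+1)) x / zdiff n (\<beta> (j+1)) (\<beta> (j+2)) x)) [1..<n-2]) z v"
proof (intro ballI allI)
  fix z and v :: "nat \<Rightarrow> point"
  assume z: "z \<in> moduli_space n"
  \<comment> \<open>The degree of the forms. For \<open>n = 3\<close> both lists are empty and the
    determinants are 1.\<close>
  define m where "m = n - 3"
  have n: "n = m + 3" using assms(1) by (simp add: m_def)
  have inj: "inj \<beta>" using assms(2) by (rule permutes_inj)
  have \<beta>_perm: "\<beta> permutes {2..<2 + m}"
  proof (rule permutes_superset[OF assms(2)])
    fix i assume "i \<in> {1..n} - {2..<2 + m}"
    then have "i = 1 \<or> i = n - 1 \<or> i = n" by (auto simp: n)
    then show "\<beta> i = i" using assms(3-5) by auto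
  qed
  \<comment> \<open>The chain is reindexed from 0, so that it runs from \<open>p 0 = 0\<close> to
    \<open>p (Suc m) = 1\<close>.\<close>
  define p where "p i = marked n z (\<beta> (Suc i))" for i
  define W where "W i j = dmarked n (\<beta> (Suc i)) z (\<lambda>_. v j)" for i j
  \<comment> \<open>The index \<open>n\<close> must be excluded: \<open>marked\<close> gives no
    meaningful value to the point at infinity.\<close>
  have \<beta>_range: "\<beta> (Suc i) \<in> {1..n-1}" if "i \<le> Suc m" for i
  proof -
    have "\<beta> (Suc i) \<in> {1..n}"
      using permutes_in_image[OF assms(2), of "Suc i"] that n by auto
    moreover have "\<beta> (Suc i) \<noteq> n"
      using inj_eq[OF inj, of "Suc i" n] assms(5) that n by auto
    ultimately show ?thesis by auto
  qed
  have p_neq: "p i \<noteq> p j" if "i \<le> Suc m" "j \<le> Suc m" "i \<noteq> j" for i j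
    unfolding p_def using that \<beta>_range inj by (intro marked_inj assms z) (auto simp: inj_eq)
  have p0: "p 0 = 0" using assms(3) by (simp add: p_def marked_def)
  have p_last: "p (Suc m) = 1" using assms(4) by (simp add: p_def marked_def n)
  have zd: "zdiff n (\<beta> (Suc i)) (\<beta> (Suc (Suc i))) z = p i - p (Suc i)" for i
    by (simp add: zdiff_def p_def)
  let ?\<omega> = "\<lambda>i j. (W i j - W (Suc i) j) / (p i - p (Suc i))"
  let ?\<alpha> = "\<lambda>j. dlog n (\<lambda>x. zdiff n (\<beta> j) (\<beta> (j+1)) x / zdiff n (\<beta> (j+1)) (\<beta> (j+2)) x)"
  have dlog: "?\<alpha> (Suc i) z w =
      (dmarked n (\<beta> (Suc i)) z w - dmarked n (\<beta> (Suc (Suc i))) z w) / (p i - p (Suc i)) -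
      (dmarked n (\<beta> (Suc (Suc i))) z w - dmarked n (\<beta> (Suc (Suc (Suc i)))) z w) /
        (p (Suc i) - p (Suc (Suc i)))" if "i < m" for i w
  proof -
    have "p i \<noteq> p (Suc i)" "p (Suc i) \<noteq> p (Suc (Suc i))"
      using that p_neq[of i "Suc i"] p_neq[of "Suc i" "Suc (Suc i)"] by simp_all
    then show ?thesis
      using dlog_zdiff_quotient[of n "\<beta> (Suc i)" "\<beta> (Suc (Suc i))" z "\<beta> (Suc (Suc i))" "\<beta> (Suc (Suc (Suc i)))" w]
      by (simp add: zd)
  qed
  define D where "D = det (mat m m (\<lambda>(i, j). v j (i + 2)))"
  have wedge_dlog: "wedge_list (map ?\<alpha> [1..<n-2]) z v = det (mat m m (\<lambda>(i, j). ?\<omega> i j - ?\<omega> (Suc i) j))"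
  proof -
    have cong: "?\<alpha> j z w = ?\<alpha> j z w'" if w: "w 0 = w' 0" and j: "j \<in> {1..<n-2}" for j w w'
    proof -
      obtain i where "j = Suc i" "i < m" using j n by (cases j) auto
      then show ?thesis
        using dlog[of i w] dlog[of i w'] dmarked_cong[of w w' n _ z, OF w] by simp
    qed
    have "wedge_list (map ?\<alpha> [1..<n-2]) z v =
        det (mat (length (map ?\<alpha> [1..<n-2])) (length (map ?\<alpha> [1..<n-2]))
          (\<lambda>(i, j). (map ?\<alpha> [1..<n-2] ! i) z (\<lambda>_. v j)))"
    proof (rule wedge_list_eq_det)
      fix \<alpha> and w w' :: "nat \<Rightarrow> point"
      assume "\<alpha> \<in> set (map ?\<alpha> [1..<n-2])" and w: "w 0 = w' 0"
      then obtain j where "j \<in> {1..<n-2}" "\<alpha> = ?\<alpha> j" by (auto simp del: upt_Suc)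
      then show "\<alpha> z w = \<alpha> z w'" using cong[of w w' j] w by simp
    qed
    also have "mat (length (map ?\<alpha> [1..<n-2])) (length (map ?\<alpha> [1..<n-2])) (\<lambda>(i, j). (map ?\<alpha> [1..<n-2] ! i) z (\<lambda>_. v j)) =
        mat m m (\<lambda>(i, j). ?\<omega> i j - ?\<omega> (Suc i) j)"
      using dlog by (intro eq_matI) (auto simp: n W_def simp del: upt_Suc)
    finally show ?thesis .
  qed
  have det_\<omega>: "det (mat m m (\<lambda>(i, j). ?\<omega> i j - ?\<omega> (Suc i) j)) * (\<Prod>i\<le>m. p i - p (Suc i)) =
      (-1) ^ Suc m * p (Suc m) * det (mat m m (\<lambda>(i, j). W (Suc i) j))"
  proof (rule det_dlog_chain)
    show "p 0 = 0" by (fact p0)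
    show "W 0 j = 0" "W (Suc m) j = 0" for j
      using assms(3,4) by (simp_all add: W_def dmarked_def n)
    show "p i \<noteq> p (Suc i)" if "i \<le> m" for i using that by (intro p_neq) auto
    show "p (Suc i) \<noteq> 0" if "i < m" for i using p_neq[of "Suc i" 0] p0 that by simp
  qed
  \<comment> \<open>The indices \<open>\<beta> (i + 2)\<close> are interior, so
    \<open>dmarked\<close> reads off a genuine coordinate.\<close>
  have W_mat: "mat m m (\<lambda>(i, j). W (Suc i) j) = mat m m (\<lambda>(i, j). v j (\<beta> (i + 2)))"
  proof (intro eq_matI)
    fix i j assume "i < dim_row (mat m m (\<lambda>(i, j). v j (\<beta> (i + 2))))"
      and "j < dim_col (mat m m (\<lambda>(i, j). v j (\<beta> (i + 2))))"
    moreover from this have "\<beta> (i + 2) \<in> {2..<2 + m}"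
      using permutes_in_image[OF \<beta>_perm, of "i + 2"] by simp
    ultimately show "mat m m (\<lambda>(i, j). W (Suc i) j) $$ (i, j) =
        mat m m (\<lambda>(i, j). v j (\<beta> (i + 2))) $$ (i, j)"
      by (auto simp: W_def dmarked_def n)
  qed auto
  \<comment> \<open>The sign \<open>(-1) ^ Suc m\<close> equals \<open>(-1) ^ n\<close> because
    \<open>n = m + 3\<close>.\<close>
  have log_form: "wedge_list (map ?\<alpha> [1..<n-2]) z v * (\<Prod>i\<le>m. p i - p (Suc i)) =
      (-1) ^ n * signof \<beta> * D"
    unfolding wedge_dlog det_\<omega> W_mat det_permute_coordinates[OF \<beta>_perm] p_last D_def
    by (simp add: n power_add)
  have "wedge_list (map dz [2..<n-1]) z v = D"
  proof -
    have "wedge_list (map dz [2..<n-1]) z v =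
        det (mat m m (\<lambda>(i, j). (map dz [2..<n-1] ! i) z (\<lambda>_. v j)))"
      by (subst wedge_list_eq_det) (auto simp: dz_def n simp del: upt_Suc)
    also have "mat m m (\<lambda>(i, j). (map dz [2..<n-1] ! i) z (\<lambda>_. v j)) = mat m m (\<lambda>(i, j). v j (i + 2))"
      by (intro eq_matI) (auto simp: dz_def n simp del: upt_Suc)
    finally show ?thesis unfolding D_def .
  qed
  moreover have "(\<Prod>j=1..n-2. zdiff n (\<beta> j) (\<beta> (j+1)) z) = (\<Prod>i\<le>m. p i - p (Suc i))"
    by (rule prod.reindex_bij_witness[of _ Suc "\<lambda>j. j - 1"]) (auto simp: n zd zdiff_def p_def)
  moreover have "(\<Prod>i\<le>m. p i - p (Suc i)) \<noteq> 0"
    using p_neq by simp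
  \<comment> \<open>The total sign is its own inverse, so it can be moved to the other side of
    \<open>log_form\<close>.\<close>
  moreover have "(-1) ^ n * signof \<beta> * ((-1) ^ n * signof \<beta> * D) = D"
  proof -
    have "(-1 :: complex) ^ n * (-1) ^ n = 1"
      by (simp flip: power_mult_distrib)
    then show ?thesis
      by (cases \<beta> rule: sign_cases) (simp_all flip: mult.assoc)
  qed
  ultimately show "parke_taylor n \<beta> z v =
      (-1) ^ n * of_int (sign \<beta>) * wedge_list (map ?\<alpha> [1..<n-2]) z v"
    unfolding parke_taylor_def using log_form
    by (simp add: divide_eq_eq mult.assoc)
qed

end
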